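(* Let $\mu$ be a probability distribution on $\binom{[n]}{k}$ and let $C>0$. If the $k\leftrightarrow k-1$ down-up walk for $\mu$ has spectral gap $\frac{1}{Ck}$, then $\mu$ is $C$-spectrally independent, i.e. $\lambda_{\max}(\Psi^{\mathrm{cor}}_\mu)\le C$.
   Context: $\binom{[n]}{k}$ is the collection of $k$-element subsets of $[n]=\{1,\dots,n\}$. Down-up walk: one step of the $k\leftrightarrow k-1$ down-up walk from $S$ (in the support of $\mu$) removes a uniformly random element of $S$ to obtain $T$ of size $k-1$, and then moves to $S'\supset T$, $|S'|=k$, with probability $\mu(S')/\sum_{S''\supset T}\mu(S'')$. It is reversible with respect to $\mu$. With transition matrix $P$ and Dirichlet form $\mathcal{E}_P(f,f)=\frac12\sum_{x,y}\mu(x)P(x,y)(f(x)-f(y))^2$, the spectral gap is the largest $\gamma$ such that $\gamma\,\mathrm{Var}_\mu[f]\le\mathcal{E}_P(f,f)$ for all functions $f$. Correlation matrix: $\Psi^{\mathrm{cor}}_\mu\in\mathbb{R}^{n\times n}$ has entries $\Psi^{\mathrm{cor}}_\mu(i,i)=1-\mathbb{P}_{S\sim\mu}[i\in S]$ and $\Psi^{\mathrm{cor}}_\mu(i,j)=\mathbb{P}_{S\sim\mu}[j\in S\mid i\in S]-\mathbb{P}_{S\sim\mu}[j\in S]$ for $i\ne j$ (indices with $\mathbb{P}_{S\sim \mu}[i\in S]=0$ are discarded). Its eigenvalues are real, and $\mu$ is $\eta$-spectrally independent if the largest eigenvalue satisfies $\lambda_{\max}(\Psi^{\mathrm{cor}}_\mu)\le\eta$.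 *)

theory Defs
  imports
    "HOL-Probability.Probability_Mass_Function"
    "Jordan_Normal_Form.Spectral_Radius"
begin

definition down_step :: "'a set \<Rightarrow> 'a set pmf" where
  "down_step S = map_pmf (\<lambda>i. S - {i}) (pmf_of_set S)"

definition up_step :: "'a set pmf \<Rightarrow> nat \<Rightarrow> 'a set \<Rightarrow> 'a set pmf" where
  "up_step \<mu> k T = cond_pmf \<mu> {S'. T \<subset> S' \<and> card S' = k}"

(* Only meaningful for S in the support of \<mu>, a distribution on k-element sets with k > 0:
   then neither pmf_of_set nor cond_pmf is used outside its domain. *)
definition down_up_walk :: "'a set pmf \<Rightarrow> nat \<Rightarrow> 'a set \<Rightarrow> 'a set pmf" where
  "down_up_walk \<mu> k S = bind_pmf (down_step S) (up_step \<mu> k)"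

(* The state space of the chain is the (finite) support of \<mu>; P x is the row of the transition
   matrix at the state x. *)
definition dirichlet_form :: "'s pmf \<Rightarrow> ('s \<Rightarrow> 's pmf) \<Rightarrow> ('s \<Rightarrow> real) \<Rightarrow> real" where
  "dirichlet_form \<mu> P f =
     1 / 2 * (\<Sum>x\<in>set_pmf \<mu>. \<Sum>y\<in>set_pmf \<mu>. pmf \<mu> x * pmf (P x) y * (f x - f y)\<^sup>2)"

definition poincare_inequality :: "'s pmf \<Rightarrow> ('s \<Rightarrow> 's pmf) \<Rightarrow> real \<Rightarrow> bool" where
  "poincare_inequality \<mu> P \<gamma> \<longleftrightarrow>
     (\<forall>f. \<gamma> * measure_pmf.variance \<mu> f \<le> dirichlet_form \<mu> P f)"

(* If \<mu> is a point mass, all variances vanish and there is no largest such constant. *)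
definition has_spectral_gap :: "'s pmf \<Rightarrow> ('s \<Rightarrow> 's pmf) \<Rightarrow> real \<Rightarrow> bool" where
  "has_spectral_gap \<mu> P \<gamma> \<longleftrightarrow>
     poincare_inequality \<mu> P \<gamma> \<and> (\<forall>\<gamma>'. poincare_inequality \<mu> P \<gamma>' \<longrightarrow> \<gamma>' \<le> \<gamma>)"

definition cor_entry :: "nat set pmf \<Rightarrow> nat \<Rightarrow> nat \<Rightarrow> real" where
  "cor_entry \<mu> i j =
     (if i = j then 1 - \<P>(S in measure_pmf \<mu>. i \<in> S)
      else \<P>(S in measure_pmf \<mu>. j \<in> S \<bar> i \<in> S) - \<P>(S in measure_pmf \<mu>. j \<in> S))"

definition cor_indices :: "nat set pmf \<Rightarrow> nat \<Rightarrow> nat list" where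
  "cor_indices \<mu> n = sorted_list_of_set {i \<in> {1..n}. \<P>(S in measure_pmf \<mu>. i \<in> S) \<noteq> 0}"

(* Rows and columns of the matrix are numbered from 0; position a stands for the a-th element of
   {1..n} that is not discarded. *)
definition cor_matrix :: "nat set pmf \<Rightarrow> nat \<Rightarrow> real mat" where
  "cor_matrix \<mu> n =
     (let is = cor_indices \<mu> n
      in mat (length is) (length is) (\<lambda>(a, b). cor_entry \<mu> (is ! a) (is ! b)))"

definition lambda_max :: "real mat \<Rightarrow> real" where
  "lambda_max A = Max (spectrum A)"

definition spectrally_independent :: "nat set pmf \<Rightarrow> nat \<Rightarrow> real \<Rightarrow> bool" where
  "spectrally_independent \<mu> n \<eta> \<longleftrightarrow> lambda_max (cor_matrix \<mu> n) \<le> \<eta>"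

end

theory Submission
  imports Defs
begin

text \<open>
  The Poincare inequality is tested on the linear functions \<open>f S = (\<Sum>i\<in>S. w i)\<close>. Write \<open>p i\<close> for
  the probability that \<open>i\<close> lies in \<open>S\<close>. The correlation matrix is the covariance matrix of the
  indicators of \<open>i \<in> S\<close> with row \<open>i\<close> divided by \<open>p i\<close>, so if \<open>w\<close> is an eigenvector for the
  eigenvalue \<open>l\<close>, then the variance of \<open>f\<close> is \<open>l * N\<close> with \<open>N = (\<Sum>i. p i * (w i)\<^sup>2) > 0\<close>
  (lemma \<open>variance_sum_over_set\<close>).

  The Dirichlet form of \<open>f\<close>, on the other hand, is at most \<open>N / k\<close>, whatever \<open>w\<close> is (lemma
  \<open>dirichlet_form_sum_le\<close>). Given the intermediate set \<open>T\<close>, the two ends of a step are independent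
  and identically distributed, so the Dirichlet form is the expected conditional variance of \<open>f S\<close>
  given \<open>T\<close>. A conditional variance is at most the conditional mean square of
  \<open>f S - f T\<close>, which is the weight \<open>w i\<close> of the removed element \<open>i\<close>; as \<open>i\<close> is uniform in \<open>S\<close>,
  the mean of \<open>(w i)\<^sup>2\<close> is \<open>N / k\<close>. The Poincare inequality with constant \<open>1 / (C * k)\<close> therefore
  gives \<open>l * N \<le> C * N\<close>, hence \<open>l \<le> C\<close>.

  For the maximum of the spectrum to be meaningful there must be a real eigenvalue at all. The size
  of \<open>S\<close> is constant, so it has covariance zero with every indicator: the rows of the correlation
  matrix sum to zero, and the all-ones vector is an eigenvector for \<open>0\<close> (lemma
  \<open>cor_entry_row_sum_zero\<close>).
\<close>

section \<open>Moments of linear functions of a random set\<close>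

definition marginal :: "'a set pmf \<Rightarrow> 'a \<Rightarrow> real" where
  "marginal \<mu> i = measure_pmf.prob \<mu> {S. i \<in> S}"

definition pair_marginal :: "'a set pmf \<Rightarrow> 'a \<Rightarrow> 'a \<Rightarrow> real" where
  "pair_marginal \<mu> i j = measure_pmf.prob \<mu> {S. i \<in> S \<and> j \<in> S}"

lemma prob_eq_sum_support:
  assumes "finite (set_pmf \<mu>)"
  shows "measure_pmf.prob \<mu> {S. Q S} = (\<Sum>S\<in>set_pmf \<mu>. pmf \<mu> S * of_bool (Q S))"
proof -
  have "measure_pmf.prob \<mu> {S. Q S} = measure_pmf.prob \<mu> ({S. Q S} \<inter> set_pmf \<mu>)"
    by (simp add: measure_Int_set_pmf)
  also have "\<dots> = (\<Sum>S\<in>{S. Q S} \<inter> set_pmf \<mu>. pmf \<mu> S)"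
    using assms by (simp add: measure_measure_pmf_finite)
  also have "\<dots> = (\<Sum>S\<in>set_pmf \<mu>. pmf \<mu> S * of_bool (Q S))"
    using assms by (intro sum.mono_neutral_cong_left) auto
  finally show ?thesis .
qed

lemma expectation_eq_sum_support:
  fixes f :: "'a \<Rightarrow> real"
  assumes "finite (set_pmf \<mu>)"
  shows "measure_pmf.expectation \<mu> f = (\<Sum>S\<in>set_pmf \<mu>. pmf \<mu> S * f S)"
  using assms by (subst integral_measure_pmf[where A = "set_pmf \<mu>"]) auto

text \<open>
  The right-hand side is the covariance of the indicators of \<open>i\<close> and \<open>j\<close>. The diagonal, which is
  defined separately, fits the same formula because \<open>pair_marginal \<mu> i i = marginal \<mu> i\<close>.
\<close>

lemma marginal_mult_cor_entry:
  assumes "marginal \<mu> i \<noteq> 0"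
  shows "marginal \<mu> i * cor_entry \<mu> i j = pair_marginal \<mu> i j - marginal \<mu> i * marginal \<mu> j"
  using assms
  by (cases "i = j")
     (auto simp: cor_entry_def cond_prob_def marginal_def pair_marginal_def right_diff_distrib
        conj_commute)

lemma expectation_sum_over_set:
  fixes w :: "'a \<Rightarrow> real"
  assumes "finite I" "finite (set_pmf \<mu>)" "\<And>S. S \<in> set_pmf \<mu> \<Longrightarrow> S \<subseteq> I"
  shows "measure_pmf.expectation \<mu> (sum w) = (\<Sum>i\<in>I. w i * marginal \<mu> i)"
    and "measure_pmf.expectation \<mu> (\<lambda>S. (sum w S)\<^sup>2) =
      (\<Sum>i\<in>I. \<Sum>j\<in>I. w i * w j * pair_marginal \<mu> i j)"
proof -
  have expand: "sum w S = (\<Sum>i\<in>I. w i * of_bool (i \<in> S))" if "S \<in> set_pmf \<mu>" for S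
    using assms(1) assms(3)[OF that] by (intro sum.mono_neutral_cong_left) auto
  have "measure_pmf.expectation \<mu> (sum w) =
      (\<Sum>S\<in>set_pmf \<mu>. \<Sum>i\<in>I. w i * (pmf \<mu> S * of_bool (i \<in> S)))"
    unfolding expectation_eq_sum_support[OF assms(2)]
    by (intro sum.cong refl) (simp only: expand, simp add: sum_distrib_left mult_ac)
  also have "\<dots> = (\<Sum>i\<in>I. w i * marginal \<mu> i)"
    by (subst sum.swap)
       (simp only: marginal_def prob_eq_sum_support[OF assms(2)] sum_distrib_left)
  finally show "measure_pmf.expectation \<mu> (sum w) = (\<Sum>i\<in>I. w i * marginal \<mu> i)" .
  have "measure_pmf.expectation \<mu> (\<lambda>S. (sum w S)\<^sup>2) =
      (\<Sum>S\<in>set_pmf \<mu>. \<Sum>i\<in>I. \<Sum>j\<in>I. w i * w j * (pmf \<mu> S * of_bool (i \<in> S \<and> j \<in> S)))"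
    unfolding expectation_eq_sum_support[OF assms(2)]
    by (intro sum.cong refl)
       (simp only: expand power2_eq_square sum_product,
        simp add: sum_distrib_left of_bool_conj mult_ac)
  also have "\<dots> = (\<Sum>i\<in>I. \<Sum>S\<in>set_pmf \<mu>. \<Sum>j\<in>I. w i * w j * (pmf \<mu> S * of_bool (i \<in> S \<and> j \<in> S)))"
    by (rule sum.swap)
  also have "\<dots> = (\<Sum>i\<in>I. \<Sum>j\<in>I. w i * w j * pair_marginal \<mu> i j)"
    unfolding pair_marginal_def prob_eq_sum_support[OF assms(2)] sum_distrib_left
    by (intro sum.cong refl sum.swap)
  finally show "measure_pmf.expectation \<mu> (\<lambda>S. (sum w S)\<^sup>2) =
      (\<Sum>i\<in>I. \<Sum>j\<in>I. w i * w j * pair_marginal \<mu> i j)" .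
qed

text \<open>
  The variance is the quadratic form of the covariance matrix at \<open>w\<close>. Written through the rows of
  the correlation matrix, it can be evaluated directly at an eigenvector.
\<close>

lemma variance_sum_over_set:
  fixes w :: "nat \<Rightarrow> real"
  assumes "finite I" "finite (set_pmf \<mu>)" "\<And>S. S \<in> set_pmf \<mu> \<Longrightarrow> S \<subseteq> I"
    and nz: "\<And>i. i \<in> I \<Longrightarrow> marginal \<mu> i \<noteq> 0"
  shows "measure_pmf.variance \<mu> (sum w) =
      (\<Sum>i\<in>I. marginal \<mu> i * w i * (\<Sum>j\<in>I. cor_entry \<mu> i j * w j))"
proof -
  have "measure_pmf.variance \<mu> (sum w) =
      (\<Sum>i\<in>I. \<Sum>j\<in>I. w i * w j * pair_marginal \<mu> i j) - (\<Sum>i\<in>I. w i * marginal \<mu> i)\<^sup>2"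
    using assms(2) by (subst measure_pmf.variance_eq)
      (auto intro: integrable_measure_pmf_finite
            simp: expectation_sum_over_set[OF assms(1-3)])
  also have "\<dots> = (\<Sum>i\<in>I. \<Sum>j\<in>I. w i * w j * (marginal \<mu> i * cor_entry \<mu> i j))"
    by (simp add: power2_eq_square sum_product sum_subtractf[symmetric]
        marginal_mult_cor_entry nz right_diff_distrib mult_ac)
  finally show ?thesis by (simp add: sum_distrib_left mult_ac)
qed

text \<open>
  After multiplication by the marginal of \<open>i\<close>, the row sum is the covariance of the indicator of
  \<open>i\<close> with \<open>card S\<close>, which is constant.
\<close>

lemma cor_entry_row_sum_zero:
  assumes "finite I" "finite (set_pmf \<mu>)" "\<And>S. S \<in> set_pmf \<mu> \<Longrightarrow> S \<subseteq> I \<and> card S = k"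
    and "marginal \<mu> i \<noteq> 0"
  shows "(\<Sum>j\<in>I. cor_entry \<mu> i j) = 0"
proof -
  have size: "(\<Sum>j\<in>I. of_bool (j \<in> S)) = real k" if "S \<in> set_pmf \<mu>" for S
  proof -
    have "(\<Sum>j\<in>I. of_bool (j \<in> S)) = (\<Sum>j\<in>S. (1::real))"
      using assms(1) assms(3)[OF that] by (intro sum.mono_neutral_cong_right) auto
    then show ?thesis using assms(3)[OF that] by simp
  qed
  have pair: "(\<Sum>j\<in>I. pair_marginal \<mu> i j) = real k * marginal \<mu> i"
  proof -
    have "(\<Sum>j\<in>I. pair_marginal \<mu> i j) =
        (\<Sum>S\<in>set_pmf \<mu>. \<Sum>j\<in>I. pmf \<mu> S * of_bool (i \<in> S) * of_bool (j \<in> S))"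
      unfolding pair_marginal_def prob_eq_sum_support[OF assms(2)]
      by (subst sum.swap) (simp add: of_bool_conj mult_ac)
    also have "\<dots> = (\<Sum>S\<in>set_pmf \<mu>. pmf \<mu> S * of_bool (i \<in> S) * real k)"
      by (simp only: sum_distrib_left[symmetric] size cong: sum.cong)
    finally show ?thesis
      by (simp add: marginal_def prob_eq_sum_support[OF assms(2)] sum_distrib_left mult_ac)
  qed
  have single: "(\<Sum>j\<in>I. marginal \<mu> j) = real k"
  proof -
    have "(\<Sum>j\<in>I. marginal \<mu> j) = (\<Sum>S\<in>set_pmf \<mu>. \<Sum>j\<in>I. pmf \<mu> S * of_bool (j \<in> S))"
      unfolding marginal_def prob_eq_sum_support[OF assms(2)] by (rule sum.swap)
    also have "\<dots> = (\<Sum>S\<in>set_pmf \<mu>. pmf \<mu> S * real k)"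
      by (simp only: sum_distrib_left[symmetric] size cong: sum.cong)
    also have "\<dots> = real k"
      using sum_pmf_eq_1[OF assms(2), of \<mu>] by (simp add: sum_distrib_right[symmetric])
    finally show ?thesis .
  qed
  have "marginal \<mu> i * (\<Sum>j\<in>I. cor_entry \<mu> i j) = 0"
    by (simp add: sum_distrib_left marginal_mult_cor_entry[OF assms(4)] sum_subtractf pair
        sum_distrib_left[symmetric] single)
  then show ?thesis using assms(4) by simp
qed

section \<open>The Dirichlet form of a linear function\<close>

text \<open>
  Up to the factor \<open>sum p X\<close>, the left-hand side is the variance of \<open>g\<close> under the normalised weights
  \<open>p\<close>, expressed through two independent copies, and the right-hand side is the second moment; their
  difference is the square of the mean.
\<close>

lemma half_pair_differences_le:
  fixes p g :: "'b \<Rightarrow> real"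
  assumes "\<And>x. x \<in> X \<Longrightarrow> p x \<ge> 0"
  shows "1 / 2 * (\<Sum>x\<in>X. \<Sum>y\<in>X. p x * (p y / sum p X) * (g x - g y)\<^sup>2) \<le> (\<Sum>x\<in>X. p x * (g x)\<^sup>2)"
proof (cases "sum p X = 0")
  case True
  (* Division by zero makes the left-hand side vanish. *)
  then show ?thesis using assms by (simp add: sum_nonneg)
next
  case False
  define M where "M = sum p X"
  define Q where "Q = (\<Sum>x\<in>X. p x * (g x)\<^sup>2)"
  have M: "M > 0" using False assms unfolding M_def by (simp add: sum_nonneg less_le)
  have "(\<Sum>x\<in>X. \<Sum>y\<in>X. p x * (p y / M) * (g x - g y)\<^sup>2) =
      (\<Sum>x\<in>X. \<Sum>y\<in>X. (p x * (g x)\<^sup>2) * p y + p x * (p y * (g y)\<^sup>2) - 2 * ((p x * g x) * (p y * g y))) / M"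
    by (simp add: sum_divide_distrib power2_eq_square algebra_simps add_divide_distrib
        diff_divide_distrib)
  also have "\<dots> = (2 * Q * M - 2 * (\<Sum>x\<in>X. p x * g x)\<^sup>2) / M"
    by (simp add: sum.distrib sum_subtractf sum_distrib_left[symmetric]
        sum_distrib_right[symmetric] M_def Q_def power2_eq_square)
  also have "\<dots> \<le> 2 * Q"
    using M by (simp add: field_simps)
  finally show ?thesis by (simp add: M_def Q_def)
qed

lemma pmf_down_up_walk:
  assumes supp: "x \<in> set_pmf \<mu>" and fin: "finite (set_pmf \<mu>)" and k: "k \<ge> 1"
    and uni: "\<And>S. S \<in> set_pmf \<mu> \<Longrightarrow> card S = k"
    and y: "y \<in> set_pmf \<mu>"
  shows "pmf (down_up_walk \<mu> k x) y =
    (\<Sum>i\<in>x. of_bool (x - {i} \<subset> y) * (pmf \<mu> y / (\<Sum>z\<in>{z \<in> set_pmf \<mu>. x - {i} \<subset> z}. pmf \<mu> z))) / k"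
proof -
  have x: "finite x" "x \<noteq> {}" "card x = k" using uni[OF supp] k by (auto intro: card_ge_0_finite)
  have up: "pmf (up_step \<mu> k (x - {i})) y =
      of_bool (x - {i} \<subset> y) * (pmf \<mu> y / (\<Sum>z\<in>{z \<in> set_pmf \<mu>. x - {i} \<subset> z}. pmf \<mu> z))"
    if "i \<in> x" for i
  proof -
    let ?A = "{S'. x - {i} \<subset> S' \<and> card S' = k}"
    have "x \<in> set_pmf \<mu> \<inter> ?A" using supp that x by auto
    then have ne: "set_pmf \<mu> \<inter> ?A \<noteq> {}" by blast
    have "measure_pmf.prob \<mu> ?A = measure_pmf.prob \<mu> (?A \<inter> set_pmf \<mu>)"
      by (simp add: measure_Int_set_pmf)
    also have "?A \<inter> set_pmf \<mu> = {z \<in> set_pmf \<mu>. x - {i} \<subset> z}" using uni by auto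
    finally have "measure_pmf.prob \<mu> ?A = (\<Sum>z\<in>{z \<in> set_pmf \<mu>. x - {i} \<subset> z}. pmf \<mu> z)"
      using fin by (simp add: measure_measure_pmf_finite)
    then show ?thesis
      unfolding up_step_def using uni[OF y] by (subst pmf_cond[OF ne]) simp
  qed
  show ?thesis
    unfolding down_up_walk_def down_step_def bind_map_pmf pmf_bind
    using x by (simp add: integral_pmf_of_set up)
qed

text \<open>
  The change of viewpoint from a state to the intermediate set: a pair of a state \<open>x\<close> and an element
  \<open>i\<close> to remove is the same as a pair of a \<open>(k - 1)\<close>-set \<open>T\<close> and a state \<open>x\<close> above it, as
  \<open>x - T\<close> is then a singleton.
\<close>

lemma sum_over_removals:
  fixes h :: "'a set \<Rightarrow> 'a set \<Rightarrow> real"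
  assumes "finite I" "finite X" "k \<ge> 1" "\<And>S. S \<in> X \<Longrightarrow> S \<subseteq> I \<and> card S = k"
  shows "(\<Sum>x\<in>X. \<Sum>i\<in>x. h x (x - {i})) =
    (\<Sum>T\<in>{T. T \<subseteq> I \<and> card T = k - 1}. \<Sum>x\<in>{x \<in> X. T \<subset> x}. h x T)"
proof -
  let ?\<T> = "{T. T \<subseteq> I \<and> card T = k - 1}"
  have inner: "(\<Sum>i\<in>x. h x (x - {i})) = (\<Sum>T\<in>{T \<in> ?\<T>. T \<subset> x}. h x T)" if "x \<in> X" for x
  proof -
    have x: "finite x" "x \<subseteq> I" "card x = k"
      using assms(1) assms(4)[OF that] finite_subset by auto
    have "(\<lambda>i. x - {i}) ` x = {T \<in> ?\<T>. T \<subset> x}"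
    proof (intro equalityI subsetI)
      fix T assume "T \<in> {T \<in> ?\<T>. T \<subset> x}"
      then have T: "T \<subset> x" "card T = k - 1" by auto
      then have "card (x - T) = 1"
        using x assms(3) by (subst card_Diff_subset) (auto intro: finite_subset)
      then obtain i where "x - T = {i}" by (auto simp: card_1_singleton_iff)
      then have "T = x - {i}" "i \<in> x" using T by auto
      then show "T \<in> (\<lambda>i. x - {i}) ` x" by blast
    qed (use x in auto)
    moreover have "inj_on (\<lambda>i. x - {i}) x" by (auto simp: inj_on_def)
    ultimately show ?thesis by (metis (no_types, lifting) sum.reindex_cong)
  qed
  have "finite ?\<T>" using assms(1) by simp
  then show ?thesis
    using assms(2) by (simp only: inner cong: sum.cong) (rule sum.swap_restrict)
qed

text \<open>
  Grouping the steps by their intermediate set \<open>T\<close> leaves, for each \<open>T\<close>, a sum over pairs of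
  states above \<open>T\<close> that the variance bound controls. Only differences of \<open>sum w\<close> enter, so it
  may be shifted by \<open>sum w T\<close> there; this makes the second moment a sum of squared weights of
  single elements.
\<close>

lemma dirichlet_form_sum_le:
  fixes w :: "'a \<Rightarrow> real"
  assumes I: "finite I" and fin: "finite (set_pmf \<mu>)" and k: "k \<ge> 1"
    and uni: "\<And>S. S \<in> set_pmf \<mu> \<Longrightarrow> S \<subseteq> I \<and> card S = k"
  shows "dirichlet_form \<mu> (down_up_walk \<mu> k) (sum w) \<le> (\<Sum>i\<in>I. marginal \<mu> i * (w i)\<^sup>2) / k"
proof -
  let ?A = "set_pmf \<mu>"
  let ?\<T> = "{T. T \<subseteq> I \<and> card T = k - 1}"
  define U where "U T = {z \<in> ?A. T \<subset> z}" for T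
  define M where "M T = sum (pmf \<mu>) (U T)" for T
  (* The contribution of the steps that start in x and pass through T, without the factor 1 / 2 of
     the Dirichlet form and the probability 1 / k of choosing T. *)
  define h where "h x T = (\<Sum>y\<in>U T. pmf \<mu> x * (pmf \<mu> y / M T) * (sum w x - sum w y)\<^sup>2)" for x T
  have fin_set: "finite x" if "x \<in> ?A" for x using uni[OF that] I finite_subset by auto
  have row: "(\<Sum>y\<in>?A. pmf \<mu> x * pmf (down_up_walk \<mu> k x) y * (sum w x - sum w y)\<^sup>2) =
      (\<Sum>i\<in>x. h x (x - {i})) / k" if x: "x \<in> ?A" for x
  proof -
    have "(\<Sum>y\<in>?A. pmf \<mu> x * pmf (down_up_walk \<mu> k x) y * (sum w x - sum w y)\<^sup>2) =
        (\<Sum>y\<in>?A. \<Sum>i\<in>x. of_bool (x - {i} \<subset> y) *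
          (pmf \<mu> x * (pmf \<mu> y / M (x - {i})) * (sum w x - sum w y)\<^sup>2)) / k"
      using pmf_down_up_walk[OF x fin k] uni unfolding sum_divide_distrib
      by (intro sum.cong refl)
         (simp add: M_def U_def sum_distrib_left sum_distrib_right sum_divide_distrib mult_ac)
    also have "\<dots> = (\<Sum>i\<in>x. \<Sum>y\<in>?A. of_bool (x - {i} \<subset> y) *
          (pmf \<mu> x * (pmf \<mu> y / M (x - {i})) * (sum w x - sum w y)\<^sup>2)) / k"
      by (subst sum.swap) simp
    also have "\<dots> = (\<Sum>i\<in>x. h x (x - {i})) / k"
      unfolding h_def U_def
      by (intro arg_cong[of _ _ "\<lambda>s. s / real k"] sum.cong refl sum.mono_neutral_cong_right)
         (use fin in auto)
    finally show ?thesis .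
  qed
  have weight: "sum w x - sum w (x - {i}) = w i" if "x \<in> ?A" "i \<in> x" for x i
    using fin_set[OF that(1)] that(2) by (simp add: sum_diff1)
  have "dirichlet_form \<mu> (down_up_walk \<mu> k) (sum w) =
      1 / 2 * (\<Sum>x\<in>?A. \<Sum>i\<in>x. h x (x - {i})) / k"
    unfolding dirichlet_form_def by (simp add: row sum_divide_distrib[symmetric])
  also have "\<dots> = (\<Sum>T\<in>?\<T>. 1 / 2 * (\<Sum>x\<in>U T. h x T)) / k"
    by (subst sum_over_removals[OF I fin k uni]) (simp_all add: U_def sum_distrib_left)
  also have "\<dots> \<le> (\<Sum>T\<in>?\<T>. \<Sum>x\<in>U T. pmf \<mu> x * (sum w x - sum w T)\<^sup>2) / k"
  proof (intro divide_right_mono sum_mono)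
    fix T
    show "1 / 2 * (\<Sum>x\<in>U T. h x T) \<le> (\<Sum>x\<in>U T. pmf \<mu> x * (sum w x - sum w T)\<^sup>2)"
      using half_pair_differences_le[of "U T" "pmf \<mu>" "\<lambda>x. sum w x - sum w T"]
      by (simp add: h_def M_def)
  qed simp
  also have "(\<Sum>T\<in>?\<T>. \<Sum>x\<in>U T. pmf \<mu> x * (sum w x - sum w T)\<^sup>2) =
      (\<Sum>x\<in>?A. \<Sum>i\<in>x. pmf \<mu> x * (sum w x - sum w (x - {i}))\<^sup>2)"
    unfolding U_def
    by (rule sum_over_removals[OF I fin k uni, symmetric, where h = "\<lambda>x T. pmf \<mu> x * (sum w x - sum w T)\<^sup>2"])
  also have "\<dots> = (\<Sum>x\<in>?A. pmf \<mu> x * (\<Sum>i\<in>x. (w i)\<^sup>2))"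
    by (simp add: weight sum_distrib_left)
  also have "\<dots> = (\<Sum>i\<in>I. marginal \<mu> i * (w i)\<^sup>2)"
    using expectation_sum_over_set(1)[OF I fin, of "\<lambda>i. (w i)\<^sup>2"] uni
    by (simp add: expectation_eq_sum_support[OF fin] mult_ac)
  finally show ?thesis .
qed

section \<open>Eigenvalues of the correlation matrix\<close>

text \<open>
  The correlation matrix numbers its rows by positions in a list of indices; this turns its
  eigenvalue equation into one about functions on the indices themselves, in which the moment
  formulas apply.
\<close>

lemma eigenvalue_mat_of_list_iff:
  fixes F :: "'b \<Rightarrow> 'b \<Rightarrow> real"
  assumes "distinct xs"
  shows "eigenvalue (mat (length xs) (length xs) (\<lambda>(a, b). F (xs ! a) (xs ! b))) l \<longleftrightarrow>
    (\<exists>w. (\<exists>i\<in>set xs. w i \<noteq> 0) \<and> (\<forall>i\<in>set xs. (\<Sum>j\<in>set xs. F i j * w j) = l * w i))"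
    (is "eigenvalue ?A l \<longleftrightarrow> ?R")
proof -
  let ?m = "length xs"
  have bij: "bij_betw ((!) xs) {0..<?m} (set xs)"
    using bij_betw_nth[OF assms, of "{0..<?m}" "set xs"] by (auto simp: atLeast0LessThan)
  have vec_iff: "vec ?m (\<lambda>a. w (xs ! a)) \<noteq> 0\<^sub>v ?m \<and>
        ?A *\<^sub>v vec ?m (\<lambda>a. w (xs ! a)) = l \<cdot>\<^sub>v vec ?m (\<lambda>a. w (xs ! a)) \<longleftrightarrow>
      (\<exists>i\<in>set xs. w i \<noteq> 0) \<and> (\<forall>i\<in>set xs. (\<Sum>j\<in>set xs. F i j * w j) = l * w i)" for w
  proof -
    have "(\<Sum>b = 0..<?m. F i (xs ! b) * w (xs ! b)) = (\<Sum>j\<in>set xs. F i j * w j)" for i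
      using sum.reindex_bij_betw[OF bij, of "\<lambda>j. F i j * w j"] by simp
    then show ?thesis
      by (simp add: vec_eq_iff scalar_prod_def all_set_conv_all_nth Bex_def in_set_conv_nth)
         blast
  qed
  show ?thesis
  proof
    assume "eigenvalue ?A l"
    then obtain v where v: "v \<in> carrier_vec ?m" "v \<noteq> 0\<^sub>v ?m" "?A *\<^sub>v v = l \<cdot>\<^sub>v v"
      by (auto simp: eigenvalue_def eigenvector_def)
    (* As xs is distinct, v can be read as a function of the entries of xs. *)
    define w where "w i = vec_index v (inv_into {0..<?m} ((!) xs) i)" for i
    have "v = vec ?m (\<lambda>a. w (xs ! a))"
      using v(1) bij by (auto simp: w_def vec_eq_iff bij_betw_def)
    then show ?R using vec_iff[of w] v(2,3) by auto
  next
    assume ?R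
    then obtain w where "(\<exists>i\<in>set xs. w i \<noteq> 0) \<and> (\<forall>i\<in>set xs. (\<Sum>j\<in>set xs. F i j * w j) = l * w i)"
      by blast
    then show "eigenvalue ?A l"
      using vec_iff[of w] unfolding eigenvalue_def eigenvector_def
      by (intro exI[of _ "vec ?m (\<lambda>a. w (xs ! a))"]) simp
  qed
qed

theorem theorem30:
  fixes \<mu> :: "nat set pmf" and n k :: nat and C :: real
  assumes "k \<ge> 1"
    and "set_pmf \<mu> \<subseteq> {S. S \<subseteq> {1..n} \<and> card S = k}"
    and "C > 0"
    and "has_spectral_gap \<mu> (down_up_walk \<mu> k) (1 / (C * real k))"
  shows "spectrally_independent \<mu> n C"
proof -
  define I where "I = {i \<in> {1..n}. marginal \<mu> i \<noteq> 0}"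
  have I: "finite I" by (simp add: I_def)
  have "finite {S. S \<subseteq> {1..n} \<and> card S = k}" by simp
  then have fin: "finite (set_pmf \<mu>)" using assms(2) finite_subset by blast
  have "marginal \<mu> i \<noteq> 0" if "S \<in> set_pmf \<mu>" "i \<in> S" for S i
    using that by (auto simp: marginal_def measure_pmf_zero_iff)
  then have uni: "S \<subseteq> I \<and> card S = k" if "S \<in> set_pmf \<mu>" for S
    using that assms(2) by (fastforce simp: I_def)
  have pos: "marginal \<mu> i > 0" if "i \<in> I" for i
    using that by (auto simp: I_def marginal_def zero_less_measure_iff)
  have nz: "marginal \<mu> i \<noteq> 0" if "i \<in> I" for i
    using that by (simp add: I_def)
  have eigen: "eigenvalue (cor_matrix \<mu> n) l \<longleftrightarrow>
      (\<exists>w. (\<exists>i\<in>I. w i \<noteq> 0) \<and> (\<forall>i\<in>I. (\<Sum>j\<in>I. cor_entry \<mu> i j * w j) = l * w i))" for l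
  proof -
    have "set (cor_indices \<mu> n) = I" "distinct (cor_indices \<mu> n)"
      by (simp_all add: cor_indices_def I_def marginal_def)
    then show ?thesis
      unfolding cor_matrix_def Let_def by (simp only: eigenvalue_mat_of_list_iff)
  qed
  have zero: "eigenvalue (cor_matrix \<mu> n) 0"
  proof -
    obtain S where "S \<in> set_pmf \<mu>" using set_pmf_not_empty by fast
    then have "I \<noteq> {}" using uni[of S] assms(1) by auto
    moreover have "(\<Sum>j\<in>I. cor_entry \<mu> i j) = 0" if "i \<in> I" for i
      by (rule cor_entry_row_sum_zero[OF I fin uni nz[OF that]])
    ultimately show ?thesis
      unfolding eigen by (intro exI[of _ "\<lambda>_. 1"]) auto
  qed
  have bound: "l \<le> C" if l: "eigenvalue (cor_matrix \<mu> n) l" for l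
  proof -
    obtain w where w: "\<exists>i\<in>I. w i \<noteq> 0" "\<And>i. i \<in> I \<Longrightarrow> (\<Sum>j\<in>I. cor_entry \<mu> i j * w j) = l * w i"
      using l unfolding eigen by blast
    define N where "N = (\<Sum>i\<in>I. marginal \<mu> i * (w i)\<^sup>2)"
    have "N > 0"
    proof -
      obtain i where "i \<in> I" "w i \<noteq> 0" using w(1) by blast
      then show ?thesis
        unfolding N_def using I pos by (intro sum_pos2[of I i]) (auto simp: less_imp_le)
    qed
    have "measure_pmf.variance \<mu> (sum w) =
        (\<Sum>i\<in>I. marginal \<mu> i * w i * (\<Sum>j\<in>I. cor_entry \<mu> i j * w j))"
      by (rule variance_sum_over_set[OF I fin conjunct1[OF uni] nz])
    also have "\<dots> = l * N"
      unfolding N_def sum_distrib_left[of l]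
      by (intro sum.cong refl) (simp add: w(2) power2_eq_square)
    finally have variance: "measure_pmf.variance \<mu> (sum w) = l * N" .
    have "1 / (C * real k) * measure_pmf.variance \<mu> (sum w) \<le>
        dirichlet_form \<mu> (down_up_walk \<mu> k) (sum w)"
      by (rule spec[OF conjunct1[OF assms(4)[unfolded has_spectral_gap_def poincare_inequality_def]]])
    also have "\<dots> \<le> N / k"
      unfolding N_def by (rule dirichlet_form_sum_le[OF I fin assms(1) uni])
    finally have "1 / (C * real k) * (l * N) \<le> N / k" unfolding variance .
    then have "l * N \<le> C * N" using assms(1,3) by (simp add: field_simps)
    then show ?thesis using \<open>N > 0\<close> by simp
  qed
  have "cor_matrix \<mu> n \<in> carrier_mat (length (cor_indices \<mu> n)) (length (cor_indices \<mu> n))"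
    by (simp add: cor_matrix_def Let_def)
  then have "finite (spectrum (cor_matrix \<mu> n))" by (rule card_finite_spectrum(1))
  then show ?thesis
    using zero bound unfolding spectrally_independent_def lambda_max_def spectrum_def
    by (subst Max_le_iff) auto
qed

end
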